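(* Let $K\neq\{0\}$ be a uniformly convex subset of a Banach space $X$ and let $\mathcal U$ be a countably incomplete ultrafilter on an infinite set $I$. Let $(x_i)_{i\in I}\in K^I$, so that $(x_i)_{\mathcal U}\in K_{\mathcal U}$. The following assertions are equivalent: (i) $(x_i)_{\mathcal U}$ is an extreme point of $K_{\mathcal U}$; (ii) for any $(y_i)_{i\in I}\in K^I$ such that $(y_i)_{\mathcal U}=(x_i)_{\mathcal U}$, it follows that $\lim_{\mathcal U}|y_i|_K=1$. If $0$ is an interior point of $K$, then they are also equivalent to: (iii) $\lim_{\mathcal U}|x_i|_K=1$.
   Context: Banach spaces are real. A free (i.e. non-principal) ultrafilter $\mathcal U$ on a set $I$ is countably incomplete if there is a sequence $(I_n)_{n\in\mathbb N}\subset\mathcal U$ with $\bigcap_n I_n=\emptyset$. The ultrapower is $X_{\mathcal U}=\ell_\infty(I,X)/\{(x_i)_{i\in I}:\lim_{\mathcal U}\|x_i\|=0\}$; the class of $(x_i)_{i\in I}$ is written $(x_i)_{\mathcal U}$ and has norm $\lim_{\mathcal U}\|x_i\|$. For bounded $A\subset X$, $A_{\mathcal U}=\{(x_i)_{\mathcal U}: x_i\in A\ \forall i\in I\}$. A symmetric bounded closed convex subset $C$ of a Banach space is uniformly convex if for every $\varepsilon>0$ there is $\delta\in(0,1)$ such that for all $x,y\in C$ with $\|x-y\|>\varepsilon$ one has $\frac{x+y}{2}\in(1-\delta)C$. $|\cdot|_K$ denotes the Minkowski functional of $K$. *)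

theory Defs
  imports "HOL-Analysis.Analysis"
begin

definition uniformly_convex_set :: "'a::real_normed_vector set \<Rightarrow> bool" where
  "uniformly_convex_set C \<longleftrightarrow>
     (\<forall>x\<in>C. - x \<in> C) \<and> bounded C \<and> closed C \<and> convex C \<and>
     (\<forall>\<epsilon>>0. \<exists>\<delta>. 0 < \<delta> \<and> \<delta> < 1 \<and>
        (\<forall>x\<in>C. \<forall>y\<in>C. norm (x - y) > \<epsilon> \<longrightarrow> (1/2) *\<^sub>R (x + y) \<in> (\<lambda>z. (1 - \<delta>) *\<^sub>R z) ` C))"

text \<open>The mathematical value is \<open>+\<infinity>\<close> when \<open>x\<close> lies in no positive multiple of \<open>K\<close>; here the
  infimum of the empty set is unspecified, so this should only be used on the cone generated by
  \<open>K\<close> (in particular on \<open>K\<close> itself).\<close>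

definition minkowski_functional :: "'a::real_vector set \<Rightarrow> 'a \<Rightarrow> real" where
  "minkowski_functional K x = Inf {t. 0 < t \<and> x \<in> (\<lambda>z. t *\<^sub>R z) ` K}"

text \<open>The index set is the universe of the type \<open>'i\<close>. A set \<open>S\<close> belongs to the ultrafilter
  iff \<open>\<forall>\<^sub>F i in U. i \<in> S\<close>.\<close>

definition ultrafilter :: "'i filter \<Rightarrow> bool" where
  "ultrafilter U \<longleftrightarrow>
     U \<noteq> bot \<and> (\<forall>S. (\<forall>\<^sub>F i in U. i \<in> S) \<or> (\<forall>\<^sub>F i in U. i \<notin> S))"

definition free_ultrafilter :: "'i filter \<Rightarrow> bool" where
  "free_ultrafilter U \<longleftrightarrow> ultrafilter U \<and> (\<forall>a. U \<noteq> principal {a})"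

definition countably_incomplete_ultrafilter :: "'i filter \<Rightarrow> bool" where
  "countably_incomplete_ultrafilter U \<longleftrightarrow>
     free_ultrafilter U \<and>
     (\<exists>J :: nat \<Rightarrow> 'i set. (\<forall>n. \<forall>\<^sub>F i in U. i \<in> J n) \<and> (\<Inter>n. J n) = {})"

text \<open>The ultrapower depends on the filter \<open>U\<close>, hence it is not a type: its points are the
  equivalence classes of bounded families, and its vector space operations are defined on
  classes.\<close>

definition linf :: "('i \<Rightarrow> 'a::real_normed_vector) set" where
  "linf = {x. bounded (range x)}"

definition ultra_rel ::
    "'i filter \<Rightarrow> (('i \<Rightarrow> 'a::real_normed_vector) \<times> ('i \<Rightarrow> 'a)) set" where
  "ultra_rel U = {(x, y). x \<in> linf \<and> y \<in> linf \<and> ((\<lambda>i. norm (x i - y i)) \<longlongrightarrow> 0) U}"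

definition ultrapower :: "'i filter \<Rightarrow> ('i \<Rightarrow> 'a::real_normed_vector) set set" where
  "ultrapower U = linf // ultra_rel U"

definition ultra_class ::
    "'i filter \<Rightarrow> ('i \<Rightarrow> 'a::real_normed_vector) \<Rightarrow> ('i \<Rightarrow> 'a) set" where
  "ultra_class U x = ultra_rel U `` {x}"

definition ultra_add ::
    "'i filter \<Rightarrow> ('i \<Rightarrow> 'a::real_normed_vector) set \<Rightarrow> ('i \<Rightarrow> 'a) set \<Rightarrow> ('i \<Rightarrow> 'a) set" where
  "ultra_add U \<xi> \<eta> = (\<Union>x\<in>\<xi>. \<Union>y\<in>\<eta>. ultra_class U (\<lambda>i. x i + y i))"

definition ultra_scale ::
    "'i filter \<Rightarrow> real \<Rightarrow> ('i \<Rightarrow> 'a::real_normed_vector) set \<Rightarrow> ('i \<Rightarrow> 'a) set" where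
  "ultra_scale U r \<xi> = (\<Union>x\<in>\<xi>. ultra_class U (\<lambda>i. r *\<^sub>R x i))"

text \<open>Meaningful for bounded \<open>A\<close>: the class of an unbounded family is empty.\<close>

definition ultra_set :: "'i filter \<Rightarrow> 'a::real_normed_vector set \<Rightarrow> ('i \<Rightarrow> 'a) set set" where
  "ultra_set U A = {ultra_class U x | x. \<forall>i. x i \<in> A}"

text \<open>The counterparts of \<^const>\<open>open_segment\<close> and \<^const>\<open>extreme_point_of\<close> in the ultrapower;
  compare \<open>in_segment\<close> and \<open>extreme_point_of_def\<close>.\<close>

definition ultra_open_segment ::
    "'i filter \<Rightarrow> ('i \<Rightarrow> 'a::real_normed_vector) set \<Rightarrow> ('i \<Rightarrow> 'a) set \<Rightarrow> ('i \<Rightarrow> 'a) set set" where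
  "ultra_open_segment U \<xi> \<eta> =
     {\<zeta>. \<xi> \<noteq> \<eta> \<and>
        (\<exists>t::real. 0 < t \<and> t < 1 \<and> \<zeta> = ultra_add U (ultra_scale U (1 - t) \<xi>) (ultra_scale U t \<eta>))}"

definition ultra_extreme_point ::
    "'i filter \<Rightarrow> ('i \<Rightarrow> 'a::real_normed_vector) set \<Rightarrow> ('i \<Rightarrow> 'a) set set \<Rightarrow> bool" where
  "ultra_extreme_point U \<zeta> S \<longleftrightarrow>
     \<zeta> \<in> S \<and> (\<forall>\<xi>\<in>S. \<forall>\<eta>\<in>S. \<zeta> \<notin> ultra_open_segment U \<xi> \<eta>)"

lemma linf_add: "x \<in> linf \<Longrightarrow> y \<in> linf \<Longrightarrow> (\<lambda>i. x i + y i) \<in> linf"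
  unfolding linf_def by (auto intro: bounded_plus_comp)

lemma linf_scale: "x \<in> linf \<Longrightarrow> (\<lambda>i. r *\<^sub>R x i) \<in> linf"
  unfolding linf_def using bounded_scaling[of "range x" r] by (simp add: image_image)

lemma ultra_rel_iff:
  "(x, y) \<in> ultra_rel U \<longleftrightarrow> x \<in> linf \<and> y \<in> linf \<and> ((\<lambda>i. x i - y i) \<longlongrightarrow> 0) U"
  by (simp add: ultra_rel_def tendsto_norm_zero_iff)

lemma equiv_ultra_rel: "equiv linf (ultra_rel U)"
proof (rule equivI)
  show "ultra_rel U \<subseteq> linf \<times> linf" by (auto simp: ultra_rel_def)
  show "refl_on linf (ultra_rel U)" by (auto simp: refl_on_def ultra_rel_def)
  show "sym (ultra_rel U)" by (auto simp: sym_def ultra_rel_def norm_minus_commute)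
  show "trans (ultra_rel U)"
  proof (rule transI)
    fix x y z
    assume a: "(x, y) \<in> ultra_rel U" "(y, z) \<in> ultra_rel U"
    have "((\<lambda>i. (x i - y i) + (y i - z i)) \<longlongrightarrow> 0 + 0) U"
      by (rule tendsto_add) (use a in \<open>auto simp: ultra_rel_iff\<close>)
    then show "(x, z) \<in> ultra_rel U" using a by (simp add: ultra_rel_iff)
  qed
qed

lemma ultra_class_eq_iff:
  assumes "x \<in> linf" "y \<in> linf"
  shows "ultra_class U x = ultra_class U y \<longleftrightarrow> ((\<lambda>i. norm (x i - y i)) \<longlongrightarrow> 0) U"
  unfolding ultra_class_def
  using eq_equiv_class_iff[OF equiv_ultra_rel assms] assms by (simp add: ultra_rel_def)

lemma ultra_class_eqI: "(x, y) \<in> ultra_rel U \<Longrightarrow> ultra_class U x = ultra_class U y"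
  by (simp add: ultra_class_eq_iff ultra_rel_def)

lemma ultra_class_self: "x \<in> linf \<Longrightarrow> x \<in> ultra_class U x"
  by (simp add: ultra_class_def ultra_rel_def)

lemma ultra_add_class:
  assumes "x \<in> linf" "y \<in> linf"
  shows "ultra_add U (ultra_class U x) (ultra_class U y) = ultra_class U (\<lambda>i. x i + y i)"
proof -
  have "ultra_class U (\<lambda>i. x' i + y' i) = ultra_class U (\<lambda>i. x i + y i)"
    if "x' \<in> ultra_class U x" "y' \<in> ultra_class U y" for x' y'
  proof -
    have *: "(x, x') \<in> ultra_rel U" "(y, y') \<in> ultra_rel U"
      using that by (auto simp: ultra_class_def)
    have "((\<lambda>i. (x i - x' i) + (y i - y' i)) \<longlongrightarrow> 0 + 0) U"
      by (rule tendsto_add) (use * in \<open>auto simp: ultra_rel_iff\<close>)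
    then have "((\<lambda>i. x i + y i), (\<lambda>i. x' i + y' i)) \<in> ultra_rel U"
      using * by (simp add: ultra_rel_iff linf_add algebra_simps)
    then show ?thesis by (simp add: ultra_class_eqI)
  qed
  then have "ultra_add U (ultra_class U x) (ultra_class U y) =
      (\<Union>x'\<in>ultra_class U x. \<Union>y'\<in>ultra_class U y. ultra_class U (\<lambda>i. x i + y i))"
    unfolding ultra_add_def by (intro SUP_cong refl)
  moreover have "ultra_class U x \<noteq> {}" "ultra_class U y \<noteq> {}"
    using ultra_class_self assms by fast+
  ultimately show ?thesis by simp
qed

lemma ultra_scale_class:
  assumes "x \<in> linf"
  shows "ultra_scale U r (ultra_class U x) = ultra_class U (\<lambda>i. r *\<^sub>R x i)"
proof -
  have "ultra_class U (\<lambda>i. r *\<^sub>R x' i) = ultra_class U (\<lambda>i. r *\<^sub>R x i)"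
    if "x' \<in> ultra_class U x" for x'
  proof -
    have *: "(x, x') \<in> ultra_rel U"
      using that by (auto simp: ultra_class_def)
    have "((\<lambda>i. r *\<^sub>R (x i - x' i)) \<longlongrightarrow> r *\<^sub>R 0) U"
      by (rule tendsto_scaleR[OF tendsto_const]) (use * in \<open>auto simp: ultra_rel_iff\<close>)
    then have "((\<lambda>i. r *\<^sub>R x i), (\<lambda>i. r *\<^sub>R x' i)) \<in> ultra_rel U"
      using * by (simp add: ultra_rel_iff linf_scale algebra_simps)
    then show ?thesis by (simp add: ultra_class_eqI)
  qed
  then have "ultra_scale U r (ultra_class U x) =
      (\<Union>x'\<in>ultra_class U x. ultra_class U (\<lambda>i. r *\<^sub>R x i))"
    unfolding ultra_scale_def by (intro SUP_cong refl)
  moreover have "ultra_class U x \<noteq> {}"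
    using ultra_class_self assms by fast
  ultimately show ?thesis by simp
qed

lemma ultra_set_subset:
  assumes "bounded A"
  shows "ultra_set U A \<subseteq> ultrapower U"
proof
  fix \<xi> assume "\<xi> \<in> ultra_set U A"
  then obtain x where x: "\<xi> = ultra_class U x" "\<forall>i. x i \<in> A"
    by (auto simp: ultra_set_def)
  then have "x \<in> linf"
    unfolding linf_def using bounded_subset[OF assms, of "range x"] by blast
  then show "\<xi> \<in> ultrapower U"
    unfolding x(1) ultrapower_def ultra_class_def by (rule quotientI)
qed

end

theory Submission
  imports Defs
begin

text \<open>If \<open>|y\<^sub>i|\<^sub>K\<close> stays below some \<open>s < 1\<close> along \<open>U\<close>, then the class of \<open>y\<close> is the midpoint of the
  distinct classes of \<open>y\<^sub>i \<plusminus> (1 - s) u\<close> with \<open>u \<in> K\<close> nonzero, hence not extreme. Conversely, a class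
  inside a nondegenerate segment of the ultrapower of \<open>K\<close> is a midpoint of two families that stay
  \<open>\<epsilon>\<close>-apart along \<open>U\<close>, and uniform convexity puts their pointwise midpoint into \<open>(1 - \<delta>) K\<close>. If \<open>0\<close>
  is interior to \<open>K\<close>, the Minkowski functional is Lipschitz, so the limit does not depend on the
  representative.\<close>

section \<open>Bounded families, multiples of a convex set and the Minkowski functional\<close>

lemma mem_linfI:
  assumes "bounded A" "\<And>i. x i \<in> A"
  shows "x \<in> linf"
  unfolding linf_def using bounded_subset[OF assms(1), of "range x"] assms(2) by blast

lemma convex_symmetric_zero_mem:
  fixes K :: "'a::real_vector set"
  assumes "convex K" "\<And>z. z \<in> K \<Longrightarrow> - z \<in> K" "z \<in> K"
  shows "0 \<in> K"
  using convexD[OF assms(1) assms(3) assms(2)[OF assms(3)], of "1/2" "1/2"] by simp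

text \<open>After division by \<open>s + t\<close> the sum is a convex combination. This is
  subadditivity of the functional at the level of multiples of \<open>K\<close>, free of
  infima.\<close>

lemma convex_scaled_add:
  fixes K :: "'a::real_vector set"
  assumes "convex K" "y \<in> (\<lambda>z. s *\<^sub>R z) ` K" "v \<in> (\<lambda>z. t *\<^sub>R z) ` K" "0 < s" "0 < t"
  shows "y + v \<in> (\<lambda>z. (s + t) *\<^sub>R z) ` K"
proof -
  obtain z w where zw: "y = s *\<^sub>R z" "z \<in> K" "v = t *\<^sub>R w" "w \<in> K"
    using assms by blast
  let ?m = "(s / (s + t)) *\<^sub>R z + (t / (s + t)) *\<^sub>R w"
  have "?m \<in> K"
    by (rule convexD[OF assms(1) zw(2) zw(4)])
       (use assms in \<open>auto simp: add_divide_distrib[symmetric]\<close>)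
  moreover have "y + v = (s + t) *\<^sub>R ?m"
    using assms zw by (simp add: scaleR_add_right)
  ultimately show ?thesis by blast
qed

lemma minkowski_functional_le:
  assumes "0 < t" "x \<in> (\<lambda>z. t *\<^sub>R z) ` K"
  shows "minkowski_functional K x \<le> t"
  unfolding minkowski_functional_def
  by (rule cInf_lower) (use assms in \<open>auto intro!: bdd_belowI[of _ 0]\<close>)

lemma minkowski_functional_le_one: "x \<in> K \<Longrightarrow> minkowski_functional K x \<le> 1"
  by (rule minkowski_functional_le) auto

text \<open>As \<open>0\<close> lies in \<open>K\<close>, the multiples of \<open>K\<close> grow
  with the factor, so an admissible \<open>t < s\<close> suffices. Membership of \<open>y\<close> in
  \<open>K\<close> makes \<open>1\<close> admissible, so the infimum is over a nonempty set.\<close>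

lemma mem_scaled_if_minkowski_functional_less:
  assumes "convex K" "0 \<in> K" "y \<in> K" "minkowski_functional K y < s"
  shows "y \<in> (\<lambda>z. s *\<^sub>R z) ` K"
proof -
  have "1 \<in> {t. 0 < t \<and> y \<in> (\<lambda>z. t *\<^sub>R z) ` K}"
    using assms by auto
  then obtain t z where t: "0 < t" "t < s" "y = t *\<^sub>R z" "z \<in> K"
    using cInf_lessD[of "{t. 0 < t \<and> y \<in> (\<lambda>z. t *\<^sub>R z) ` K}" s] assms(4)
    unfolding minkowski_functional_def by blast
  have "(t / s) *\<^sub>R z \<in> K"
    using convexD[OF assms(1) t(4) assms(2), of "t / s" "1 - t / s"] t by simp
  moreover have "y = s *\<^sub>R ((t / s) *\<^sub>R z)"
    using t by simp
  ultimately show ?thesis by blast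
qed

text \<open>The ball puts \<open>x - y\<close> into \<open>e\<close> times \<open>K\<close> with
  \<open>e = norm (x - y) / r\<close>, so each \<open>t\<close> admissible for \<open>y\<close>
  gives \<open>t + e\<close> admissible for \<open>x\<close>. The case \<open>x = y\<close> is split
  off because scale factors must be positive.\<close>

lemma minkowski_functional_lipschitz:
  fixes K :: "'a::real_normed_vector set"
  assumes "convex K" "0 < r" "cball 0 r \<subseteq> K" "y \<in> K"
  shows "minkowski_functional K x \<le> minkowski_functional K y + norm (x - y) / r"
proof (cases "x = y")
  case False
  define e where "e = norm (x - y) / r"
  have e: "0 < e"
    using False assms(2) by (simp add: e_def)
  have "(1 / e) *\<^sub>R (x - y) \<in> K"
    using assms e by (intro subsetD[OF assms(3)]) (simp add: e_def)
  moreover have "x - y = e *\<^sub>R ((1 / e) *\<^sub>R (x - y))"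
    using e by simp
  ultimately have xy: "x - y \<in> (\<lambda>z. e *\<^sub>R z) ` K"
    by blast
  have "minkowski_functional K x - e \<le> minkowski_functional K y"
    unfolding minkowski_functional_def[of K y]
  proof (rule cInf_greatest)
    have "1 \<in> {t. 0 < t \<and> y \<in> (\<lambda>z. t *\<^sub>R z) ` K}"
      using assms by auto
    then show "{t. 0 < t \<and> y \<in> (\<lambda>z. t *\<^sub>R z) ` K} \<noteq> {}" by blast
  next
    fix t assume t: "t \<in> {t. 0 < t \<and> y \<in> (\<lambda>z. t *\<^sub>R z) ` K}"
    then have "x \<in> (\<lambda>z. (t + e) *\<^sub>R z) ` K"
      using convex_scaled_add[OF assms(1) _ xy, of y t] e by simp
    then show "minkowski_functional K x - e \<le> t"
      using minkowski_functional_le[of "t + e" x K] t e by simp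
  qed
  then show ?thesis by (simp add: e_def)
qed simp

section \<open>Extreme points of the ultrapower of \<open>K\<close> and limits of the
  functional\<close>

lemma ultrafilter_not_eventually:
  assumes "ultrafilter U" "\<not> (\<forall>\<^sub>F i in U. P i)"
  shows "\<forall>\<^sub>F i in U. \<not> P i"
proof -
  have "(\<forall>\<^sub>F i in U. i \<in> Collect P) \<or> (\<forall>\<^sub>F i in U. i \<notin> Collect P)"
    using assms(1) unfolding ultrafilter_def by blast
  then show ?thesis using assms(2) by simp
qed

lemma ultra_extreme_point_limit:
  fixes K :: "'a::real_normed_vector set"
  assumes U: "ultrafilter U"
    and K: "bounded K" "convex K" "\<And>z. z \<in> K \<Longrightarrow> - z \<in> K" "K \<noteq> {0}"
    and y: "\<And>i. y i \<in> K"
    and ext: "ultra_extreme_point U (ultra_class U y) (ultra_set U K)"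
  shows "((\<lambda>i. minkowski_functional K (y i)) \<longlongrightarrow> 1) U"
proof (rule order_tendstoI)
  \<comment> \<open>The upper bound holds at every index because \<open>y i\<close> lies in
    \<open>K\<close>; only the lower bound uses extremality.\<close>
  fix a :: real assume "1 < a"
  then show "\<forall>\<^sub>F i in U. minkowski_functional K (y i) < a"
    by (intro always_eventually allI) (rule order.strict_trans1[OF minkowski_functional_le_one[OF y]])
next
  fix a :: real assume a: "a < 1"
  have zero: "0 \<in> K"
    using convex_symmetric_zero_mem[OF K(2,3) y] .
  then obtain u where u: "u \<in> K" "u \<noteq> 0"
    using K(4) by blast
  \<comment> \<open>The maximum with \<open>0\<close> keeps \<open>s\<close> positive even for
    negative \<open>a\<close>.\<close>
  define s where "s = (max a 0 + 1) / 2"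
  have s: "a < s" "0 < s" "s < 1"
    using a by (auto simp: s_def)
  show "\<forall>\<^sub>F i in U. a < minkowski_functional K (y i)"
  proof (rule ccontr)
    assume "\<not> ?thesis"
    then have "\<forall>\<^sub>F i in U. \<not> a < minkowski_functional K (y i)"
      by (rule ultrafilter_not_eventually[OF U])
    then have ev: "\<forall>\<^sub>F i in U. y i \<in> (\<lambda>z. s *\<^sub>R z) ` K"
      by eventually_elim
         (use s in \<open>auto intro!: mem_scaled_if_minkowski_functional_less[OF K(2) zero y]\<close>)
    \<comment> \<open>Representatives must lie in \<open>K\<close> at every index, but
      \<open>ev\<close> speaks only of indices along \<open>U\<close>; elsewhere \<open>y i\<close>
      is left alone.\<close>
    define w where "w v i = (if y i \<in> (\<lambda>z. s *\<^sub>R z) ` K then y i + (1 - s) *\<^sub>R v else y i)" for v i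
    have wK: "w v i \<in> K" if "v \<in> K" for v i
      using convex_scaled_add[OF K(2), of "y i" s "(1 - s) *\<^sub>R v" "1 - s"] s y[of i] that
      by (auto simp: w_def)
    have wl: "w u \<in> linf" "w (- u) \<in> linf"
      by (auto intro!: mem_linfI[OF K(1)] wK u(1) K(3))
    have "ultra_class U (w u) \<noteq> ultra_class U (w (- u))"
    proof
      assume "ultra_class U (w u) = ultra_class U (w (- u))"
      then have "((\<lambda>i. norm (w u i - w (- u) i)) \<longlongrightarrow> 0) U"
        using ultra_class_eq_iff[OF wl] by blast
      moreover have "\<forall>\<^sub>F i in U. norm (w u i - w (- u) i) = norm ((2 * (1 - s)) *\<^sub>R u)"
        using ev by eventually_elim (simp add: w_def scaleR_2[symmetric])
      ultimately have "((\<lambda>i. norm ((2 * (1 - s)) *\<^sub>R u)) \<longlongrightarrow> 0) U"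
        by (simp only: tendsto_cong)
      then have "norm ((2 * (1 - s)) *\<^sub>R u) = 0"
        using U tendsto_const_iff unfolding ultrafilter_def by blast
      then show False using u s by simp
    qed
    moreover have "ultra_class U y =
        ultra_add U (ultra_scale U (1 - 1/2) (ultra_class U (w u)))
          (ultra_scale U (1/2) (ultra_class U (w (- u))))"
    proof -
      have "(1/2) *\<^sub>R w u i + (1/2) *\<^sub>R w (- u) i = y i" for i
        by (simp add: w_def scaleR_add_right[symmetric] scaleR_2[symmetric])
      then show ?thesis
        by (simp add: ultra_scale_class ultra_add_class linf_scale wl)
    qed
    ultimately have "ultra_class U y \<in>
        ultra_open_segment U (ultra_class U (w u)) (ultra_class U (w (- u)))"
      unfolding ultra_open_segment_def by (intro CollectI conjI exI[of _ "1/2"]) simp_all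
    moreover have "ultra_class U (w u) \<in> ultra_set U K" "ultra_class U (w (- u)) \<in> ultra_set U K"
      using wK[OF u(1)] wK[OF K(3)[OF u(1)]] by (auto simp: ultra_set_def)
    ultimately show False
      using ext unfolding ultra_extreme_point_def by blast
  qed
qed

text \<open>The assumption \<open>lim\<close> is applied to the representative built from the
  endpoints of a segment through the class, not to \<open>x\<close> itself.\<close>

lemma ultra_extreme_pointI_limit:
  fixes K :: "'a::real_normed_vector set"
  assumes U: "ultrafilter U"
    and K: "uniformly_convex_set K"
    and x: "\<And>i. x i \<in> K"
    and lim: "\<And>y. (\<And>i. y i \<in> K) \<Longrightarrow> ultra_class U y = ultra_class U x \<Longrightarrow>
      ((\<lambda>i. minkowski_functional K (y i)) \<longlongrightarrow> 1) U"
  shows "ultra_extreme_point U (ultra_class U x) (ultra_set U K)"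
  unfolding ultra_extreme_point_def
proof (intro conjI ballI notI)
  show "ultra_class U x \<in> ultra_set U K"
    using x by (auto simp: ultra_set_def)
next
  have bnd: "bounded K" and cvx: "convex K"
    using K by (auto simp: uniformly_convex_set_def)
  fix \<xi> \<eta>
  assume "\<xi> \<in> ultra_set U K" "\<eta> \<in> ultra_set U K"
    and seg: "ultra_class U x \<in> ultra_open_segment U \<xi> \<eta>"
  then obtain a b where ab: "\<And>i. a i \<in> K" "\<And>i. b i \<in> K" "\<xi> = ultra_class U a" "\<eta> = ultra_class U b"
    unfolding ultra_set_def by blast
  have l: "a \<in> linf" "b \<in> linf"
    using mem_linfI[OF bnd] ab(1,2) by blast+
  obtain t where t: "0 < t" "t < 1"
    and xt: "ultra_class U x = ultra_add U (ultra_scale U (1 - t) \<xi>) (ultra_scale U t \<eta>)"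
    and ne: "\<xi> \<noteq> \<eta>"
    using seg unfolding ultra_open_segment_def by blast
  define y where "y i = (1 - t) *\<^sub>R a i + t *\<^sub>R b i" for i
  have yK: "y i \<in> K" for i
    unfolding y_def by (rule convexD[OF cvx ab(1,2)]) (use t in auto)
  have "ultra_class U y = ultra_class U x"
    unfolding xt ab y_def by (simp add: ultra_scale_class ultra_add_class linf_scale l)
  then have y1: "((\<lambda>i. minkowski_functional K (y i)) \<longlongrightarrow> 1) U"
    using lim yK by blast
  have "\<not> ((\<lambda>i. norm (a i - b i)) \<longlongrightarrow> 0) U"
    using ne ab ultra_class_eq_iff[OF l] by blast
  then obtain e where e: "0 < e" "\<not> (\<forall>\<^sub>F i in U. norm (a i - b i) < e)"
    by (auto simp: tendsto_iff)
  then have ev: "\<forall>\<^sub>F i in U. \<not> norm (a i - b i) < e"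
    by (intro ultrafilter_not_eventually[OF U])
  \<comment> \<open>The class of \<open>x\<close> need not be the midpoint of the segment. This
    \<open>s\<close> is the largest shift for which both \<open>y i + s (a i - b i)\<close> and
    \<open>y i - s (a i - b i)\<close> keep nonnegative weights on \<open>a i\<close> and
    \<open>b i\<close>.\<close>
  define s where "s = min t (1 - t)"
  have s: "0 < s" "s \<le> t" "s \<le> 1 - t"
    using t by (auto simp: s_def)
  define p where "p i = y i + s *\<^sub>R (a i - b i)" for i
  define q where "q i = y i - s *\<^sub>R (a i - b i)" for i
  have "p i = (1 - t + s) *\<^sub>R a i + (t - s) *\<^sub>R b i"
    "q i = (1 - t - s) *\<^sub>R a i + (t + s) *\<^sub>R b i" for i
    unfolding p_def q_def y_def by (simp_all add: algebra_simps)
  then have pq: "p i \<in> K" "q i \<in> K" for i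
    using convexD[OF cvx ab(1)[of i] ab(2)[of i], of "1 - t + s" "t - s"]
      convexD[OF cvx ab(1)[of i] ab(2)[of i], of "1 - t - s" "t + s"] s t by simp_all
  have mid: "(1/2) *\<^sub>R (p i + q i) = y i" for i
    by (simp add: p_def q_def scaleR_2[symmetric])
  have "p i - q i = (2 * s) *\<^sub>R (a i - b i)" for i
    by (simp add: p_def q_def scaleR_2[symmetric])
  then have dist: "norm (p i - q i) = 2 * s * norm (a i - b i)" for i
    using s by simp
  \<comment> \<open>Along \<open>U\<close> the distance of \<open>p i\<close> and \<open>q i\<close>
    is at least \<open>2 * s * e\<close>; half of that serves as threshold, since uniform convexity
    asks for a strict inequality.\<close>
  have "0 < s * e"
    using s e by simp
  then obtain d where d: "0 < d" "d < 1"
    and ucd: "\<And>v w. v \<in> K \<Longrightarrow> w \<in> K \<Longrightarrow> s * e < norm (v - w) \<Longrightarrow>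
      (1/2) *\<^sub>R (v + w) \<in> (\<lambda>z. (1 - d) *\<^sub>R z) ` K"
    using K unfolding uniformly_convex_set_def by meson
  have "\<forall>\<^sub>F i in U. minkowski_functional K (y i) \<le> 1 - d"
    using ev
  proof eventually_elim
    case (elim i)
    then have "s * e \<le> s * norm (a i - b i)"
      using s by simp
    then have "s * e < norm (p i - q i)"
      using \<open>0 < s * e\<close> by (simp add: dist)
    then show ?case
      using ucd[OF pq, of i i] d mid[of i] by (auto intro!: minkowski_functional_le)
  qed
  then have "1 \<le> 1 - d"
    using tendsto_upperbound[OF y1] U by (auto simp: ultrafilter_def)
  then show False using d by simp
qed

section \<open>Change of representative when \<open>0\<close> is interior to \<open>K\<close>, and
  the equivalences\<close>

lemma minkowski_functional_limit_representative:
  fixes K :: "'a::real_normed_vector set"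
  assumes K: "bounded K" "convex K" "0 \<in> interior K"
    and x: "\<And>i. x i \<in> K" and y: "\<And>i. y i \<in> K"
    and eq: "ultra_class U y = ultra_class U x"
    and lim: "((\<lambda>i. minkowski_functional K (x i)) \<longlongrightarrow> c) U"
  shows "((\<lambda>i. minkowski_functional K (y i)) \<longlongrightarrow> c) U"
proof -
  obtain r where r: "0 < r" "cball 0 r \<subseteq> K"
    using K(3) unfolding mem_interior_cball by blast
  have "x \<in> linf" "y \<in> linf"
    using mem_linfI[OF K(1)] x y by blast+
  then have "((\<lambda>i. norm (y i - x i)) \<longlongrightarrow> 0) U"
    using eq ultra_class_eq_iff by blast
  then have n: "((\<lambda>i. norm (y i - x i) / r) \<longlongrightarrow> 0) U"
    using tendsto_divide_zero by blast
  \<comment> \<open>Both families lie in \<open>K\<close>, so the one-sided Lipschitz bound can be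
    used in both orders.\<close>
  have "norm (minkowski_functional K (y i) - minkowski_functional K (x i)) \<le> norm (y i - x i) / r" for i
    using minkowski_functional_lipschitz[OF K(2) r x[of i], of "y i"]
      minkowski_functional_lipschitz[OF K(2) r y[of i], of "x i"]
    by (simp add: norm_minus_commute abs_le_iff)
  then have "((\<lambda>i. minkowski_functional K (y i) - minkowski_functional K (x i)) \<longlongrightarrow> 0) U"
    by (intro Lim_null_comparison[OF _ n] always_eventually allI)
  from tendsto_add[OF this lim] show ?thesis by simp
qed

theorem theorem4p11:
  fixes K :: "'a::banach set" and U :: "'i filter" and x :: "'i \<Rightarrow> 'a"
  assumes "uniformly_convex_set K" and "K \<noteq> {0}"
    and "infinite (UNIV :: 'i set)" and "countably_incomplete_ultrafilter U"
    and "\<forall>i. x i \<in> K"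
  shows "(ultra_extreme_point U (ultra_class U x) (ultra_set U K) \<longleftrightarrow>
            (\<forall>y :: 'i \<Rightarrow> 'a. (\<forall>i. y i \<in> K) \<and> ultra_class U y = ultra_class U x \<longrightarrow>
               ((\<lambda>i. minkowski_functional K (y i)) \<longlongrightarrow> 1) U)) \<and>
         (0 \<in> interior K \<longrightarrow>
            (ultra_extreme_point U (ultra_class U x) (ultra_set U K) \<longleftrightarrow>
               ((\<lambda>i. minkowski_functional K (x i)) \<longlongrightarrow> 1) U))"
proof -
  have U: "ultrafilter U"
    using assms(4) by (simp add: countably_incomplete_ultrafilter_def free_ultrafilter_def)
  have K: "bounded K" "convex K" "\<And>z. z \<in> K \<Longrightarrow> - z \<in> K"
    using assms(1) by (auto simp: uniformly_convex_set_def)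
  have x: "\<And>i. x i \<in> K"
    using assms(5) by blast
  have "ultra_extreme_point U (ultra_class U x) (ultra_set U K) \<longleftrightarrow>
      (\<forall>y :: 'i \<Rightarrow> 'a. (\<forall>i. y i \<in> K) \<and> ultra_class U y = ultra_class U x \<longrightarrow>
        ((\<lambda>i. minkowski_functional K (y i)) \<longlongrightarrow> 1) U)" (is "?ext \<longleftrightarrow> ?lim")
  proof
    assume ?ext
    then show ?lim
      by (intro allI impI) (rule ultra_extreme_point_limit[OF U K assms(2)]; simp)
  next
    assume ?lim
    then show ?ext
      by (intro ultra_extreme_pointI_limit[OF U assms(1) x]) blast
  qed
  \<comment> \<open>Assertion (iii) is compared with (ii) instead of with extremality: one direction
    takes \<open>y = x\<close>, the other changes the representative.\<close>
  moreover have "?lim \<longleftrightarrow> ((\<lambda>i. minkowski_functional K (x i)) \<longlongrightarrow> 1) U" if "0 \<in> interior K"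
  proof
    assume ?lim
    then show "((\<lambda>i. minkowski_functional K (x i)) \<longlongrightarrow> 1) U"
      using x by blast
  next
    assume lim: "((\<lambda>i. minkowski_functional K (x i)) \<longlongrightarrow> 1) U"
    show ?lim
      by (intro allI impI, rule minkowski_functional_limit_representative[OF K(1,2) that x _ _ lim])
         simp_all
  qed
  ultimately show ?thesis by blast
qed

end
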